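(* There is a function $M:(0,\infty)\times[2,3]\to[0,\infty]$, $(\delta,q)\mapsto M(\delta,q)$, which is monotonic decreasing in its second argument and satisfies $M(\delta,3)=\sqrt[3]{2}\,\delta$ and $M(\delta,2)=\infty$ for every $\delta>0$, such that for every $q\in[2,3]$ and $\delta>0$ the following holds: for all sufficiently large $N$, every set $E\subset[N]$ of density $|E|/N\ge\delta$ with $\|\widehat{E}\|_{\ell^q}<M(\delta,q)$ contains a non-trivial three-term arithmetic progression.
   Context: $[N]=\{0,1,\dots,N-1\}$. The set $E$ is identified with its indicator function on $\mathbb{Z}_N=\mathbb{Z}/N\mathbb{Z}$ (with normalized counting measure), $\widehat{E}(\xi)=\frac1N\sum_{x\in E}e^{2\pi i x\xi/N}$ for $\xi\in\mathbb{Z}_N$, and $\|\widehat E\|_{\ell^q}=\left(\sum_{\xi\in\mathbb{Z}_N}|\widehat{E}(\xi)|^q\right)^{1/q}$. A non-trivial three-term arithmetic progression is a triple $x,x+r,x+2r$ of integers with $r\ne0$. *)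

theory Defs
  imports Complex_Main "HOL-Library.Extended_Nonnegative_Real"
begin

text \<open>
  \<open>\<int>\<^sub>N\<close> carries normalized counting measure and is represented by the residues
  \<open>{0..<int N}\<close>; for \<open>E \<subseteq> {0..<int N}\<close> the coefficient below depends on \<open>\<xi>\<close> only modulo \<open>N\<close>.
\<close>

definition fourier_coeff :: "nat \<Rightarrow> int set \<Rightarrow> int \<Rightarrow> complex" where
  "fourier_coeff N E \<xi> =
     (1 / of_nat N) * (\<Sum>x\<in>E. exp (2 * of_real pi * \<i> * of_int x * of_int \<xi> / of_nat N))"

text \<open>The frequency side carries counting measure, so this sum is not normalized.\<close>

definition fourier_lq_norm :: "nat \<Rightarrow> real \<Rightarrow> int set \<Rightarrow> real" where
  "fourier_lq_norm N q E =
     (\<Sum>\<xi>\<in>{0..<int N}. cmod (fourier_coeff N E \<xi>) powr q) powr (1 / q)"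

definition contains_nontrivial_3ap :: "int set \<Rightarrow> bool" where
  "contains_nontrivial_3ap E \<longleftrightarrow>
     (\<exists>x r. r \<noteq> 0 \<and> x \<in> E \<and> x + r \<in> E \<and> x + 2 * r \<in> E)"

end

theory Submission
  imports Defs
begin

text \<open>
  The requirement \<open>M \<delta> 2 = \<infinity>\<close> turns the case \<open>q = 2\<close> into Roth's theorem: the Fourier norm is
  a real number, so every set of density at least \<open>\<delta>\<close> must contain a progression once \<open>N\<close> is
  large. Roth's theorem in turn covers every other \<open>q\<close>, so that any decreasing function with the
  prescribed values at \<open>2\<close> and \<open>3\<close> serves as \<open>M \<delta>\<close>; a step function is taken below.

  Roth's theorem is proved by Szemeredi's combinatorial argument. Let \<open>c\<close> be the infimum of the
  densities that force a progression, and suppose \<open>c > 0\<close>. There are arbitrarily large \<open>N\<close> and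
  progression-free \<open>A \<subseteq> {0..<N}\<close> of density almost \<open>c\<close>, while on no long arithmetic progression
  does \<open>A\<close> have density noticeably above \<open>c\<close> (lemma \<open>roth_density_progressions\<close>). In particular
  \<open>A\<close> has density almost \<open>c\<close> on each of the first two quarters of the interval.

  The first quarter of \<open>A\<close> contains a Hilbert cube of any prescribed dimension \<open>d\<close> whose steps are
  bounded independently of \<open>N\<close> (lemma \<open>dense_set_contains_cube\<close>). Reflecting a point \<open>q\<close> of the
  cube in a point \<open>m\<close> of the second quarter of \<open>A\<close> gives \<open>2 * m - q\<close>, the third term of a
  progression \<open>q, m, 2 * m - q\<close>; so the set of all these reflections avoids \<open>A\<close>. As the
  cube is built up one step \<open>x\<close> at a time, the set \<open>T\<close> of reflections changes to \<open>T \<union> (T + x)\<close>. It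
  stays inside \<open>{0..<N}\<close>, so one of the \<open>d\<close> steps enlarges it by at most \<open>N / d\<close>
  (lemma \<open>exists_slow_growth\<close>). At that stage \<open>T\<close> is nearly invariant under translation by the
  bounded number \<open>x\<close>, and its complement is a union of few progressions of difference \<open>x\<close>, on which
  \<open>A\<close> has density at most slightly above \<open>c\<close>. Hence \<open>A\<close> has size about \<open>c * (N - card T)\<close> at
  most (lemma \<open>card_complement_of_slowly_growing\<close>). But \<open>card T\<close> is a positive proportion of \<open>N\<close>, so this
  is less than the size of \<open>A\<close>.
\<close>

section \<open>Hilbert cubes with bounded steps\<close>

text \<open>
  The sign of the steps is chosen so that reflecting the cube turns each step into a translation in
  the positive direction. With the recursion on the head of the list, the suffixes of \<open>xs\<close> give an
  increasing chain of subcubes of \<open>cube a xs\<close>.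
\<close>

fun cube :: "int \<Rightarrow> int list \<Rightarrow> int set" where
  "cube a [] = {a}"
| "cube a (x # xs) = cube a xs \<union> (\<lambda>q. q - x) ` cube a xs"

text \<open>
  Elements of \<open>B\<close> that have no element of \<open>B\<close> within distance \<open>X\<close> below them are more than \<open>X\<close>
  apart, hence at most about \<open>n / X\<close> in number. For large \<open>X\<close> this leaves at least half of \<open>B\<close>,
  and by pigeonhole over the \<open>X\<close> possible distances many of these elements share one.
\<close>

lemma many_elements_with_common_step:
  fixes \<beta> :: real
  assumes "\<beta> > 0"
  shows "\<exists>X n0. \<exists>\<beta>'>0. \<forall>n\<ge>n0. \<forall>B \<subseteq> {0..<int n}. \<beta> * real n \<le> real (card B) \<longrightarrow>
    (\<exists>x\<in>{1..int X}. \<beta>' * real n \<le> real (card {b\<in>B. b - x \<in> B}))"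
proof -
  obtain X :: nat where X: "4 / \<beta> < real X"
    using reals_Archimedean2 by blast
  have X0: "X > 0"
    using X assms by (cases X) (auto simp: divide_less_0_iff)
  have X4: "4 < \<beta> * real X"
    using X assms by (simp add: field_simps)
  obtain n0 :: nat where n0: "4 / \<beta> < real n0"
    using reals_Archimedean2 by blast
  define \<beta>' where "\<beta>' = \<beta> / (2 * real X)"
  have "\<beta>' > 0"
    using assms X0 by (simp add: \<beta>'_def)
  moreover have "\<exists>x\<in>{1..int X}. \<beta>' * real n \<le> real (card {b\<in>B. b - x \<in> B})"
    if n: "n \<ge> n0" and B: "B \<subseteq> {0..<int n}" and card_B: "\<beta> * real n \<le> real (card B)" for n B
  proof (rule ccontr)
    assume contra: "\<not> ?thesis"
    define I where "I = {b\<in>B. \<forall>x\<in>{1..int X}. b - x \<notin> B}"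
    have finB: "finite B" using B finite_subset by blast
    have "inj_on (\<lambda>b. b div int X) I"
    proof (rule linorder_inj_onI)
      fix b b' assume bb: "b < b'" "b \<in> I" "b' \<in> I"
      have "b \<in> B" using bb by (simp add: I_def)
      have "int X < b' - b"
      proof (rule ccontr)
        assume "\<not> ?thesis"
        then have "b' - b \<in> {1..int X}" using bb by auto
        then have "b' - (b' - b) \<notin> B" using bb unfolding I_def by blast
        then show False using \<open>b \<in> B\<close> by simp
      qed
      then have "(b + int X) div int X \<le> b' div int X"
        using X0 by (intro zdiv_mono1) auto
      then show "b div int X \<noteq> b' div int X" using X0 by simp
    qed auto
    moreover have "(\<lambda>b. b div int X) ` I \<subseteq> {0..int n div int X}"
          proof
      fix y assume "y \<in> (\<lambda>b. b div int X) ` I"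
      then obtain b where "b \<in> B" "y = b div int X" unfolding I_def by auto
      moreover from this have "0 \<le> b" "b \<le> int n" using B by auto
      ultimately show "y \<in> {0..int n div int X}"
        using X0 by (simp add: pos_imp_zdiv_nonneg_iff zdiv_mono1)
    qed
    ultimately have "card I \<le> card {0..int n div int X}"
      using card_inj_on_le by blast
    then have "card I \<le> n div X + 1"
      by (simp add: zdiv_int[symmetric] nat_add_distrib)
    then have "real (card I) \<le> real (n div X) + 1" by linarith
    also have "real (n div X) \<le> real n / real X"
      by (rule of_nat_div_le_of_nat)
    also have "real n / real X \<le> \<beta> * real n / 4"
      using X4 X0 mult_right_mono[of 4 "\<beta> * real X" "real n"] by (simp add: field_simps)
    finally have card_I: "real (card I) \<le> \<beta> * real n / 4 + 1" by simp
    have "4 / \<beta> < real n" using n0 n by linarith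
    then have n_pos: "4 < \<beta> * real n" using assms by (simp add: field_simps)
    have "B \<subseteq> I \<union> (\<Union>x\<in>{1..int X}. {b\<in>B. b - x \<in> B})"
      unfolding I_def by blast
    moreover have "finite (I \<union> (\<Union>x\<in>{1..int X}. {b\<in>B. b - x \<in> B}))"
      using finB by (auto simp: I_def)
    ultimately have "card B \<le> card (I \<union> (\<Union>x\<in>{1..int X}. {b\<in>B. b - x \<in> B}))"
      by (rule card_mono[rotated])
    also have "\<dots> \<le> card I + card (\<Union>x\<in>{1..int X}. {b\<in>B. b - x \<in> B})"
      by (rule card_Un_le)
    also have "card (\<Union>x\<in>{1..int X}. {b\<in>B. b - x \<in> B}) \<le> (\<Sum>x\<in>{1..int X}. card {b\<in>B. b - x \<in> B})"
      by (rule card_UN_le) simp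
    finally have "real (card B) \<le> real (card I) + (\<Sum>x\<in>{1..int X}. real (card {b\<in>B. b - x \<in> B}))"
      by (simp flip: of_nat_sum of_nat_add)
    also have "(\<Sum>x\<in>{1..int X}. real (card {b\<in>B. b - x \<in> B})) \<le> (\<Sum>x\<in>{1..int X}. \<beta>' * real n)"
      using contra by (intro sum_mono) force
    also have "\<dots> = \<beta> * real n / 2"
      using X0 by (simp add: \<beta>'_def)
    finally show False using card_I card_B n_pos by linarith
  qed
  ultimately show ?thesis by blast
qed

text \<open>
  If \<open>x\<close> is a popular difference of \<open>B\<close>, then a cube inside \<open>{b \<in> B. b - x \<in> B}\<close> can be extended by the
  step \<open>x\<close> inside \<open>B\<close>. The density lost on the way depends on \<open>\<beta>\<close> only, so induction on the
  dimension keeps the steps bounded independently of \<open>n\<close>.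
\<close>

lemma dense_set_contains_cube:
  fixes \<beta> :: real
  assumes "\<beta> > 0"
  shows "\<exists>X n0. \<forall>n\<ge>n0. \<forall>B \<subseteq> {0..<int n}. \<beta> * real n \<le> real (card B) \<longrightarrow>
          (\<exists>a xs. length xs = d \<and> set xs \<subseteq> {1..int X} \<and> cube a xs \<subseteq> B)"
  using assms
proof (induction d arbitrary: \<beta>)
  case 0
  have "\<exists>a. a \<in> B" if "n \<ge> 1" "\<beta> * real n \<le> real (card B)" for n and B :: "int set"
  proof -
    have "0 < \<beta> * real n" using 0 that by simp
    then have "card B \<noteq> 0" using that by linarith
    then show ?thesis by (metis card.empty ex_in_conv)
  qed
  then have "\<exists>a xs. length xs = 0 \<and> set xs \<subseteq> {1..int 0} \<and> cube a xs \<subseteq> B"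
    if "n \<ge> 1" "\<beta> * real n \<le> real (card B)" for n B
    using that by simp
  then show ?case by blast
next
  case (Suc d)
  obtain X \<beta>' n0 where \<beta>': "\<beta>' > 0" and step:
    "\<forall>n\<ge>n0. \<forall>B \<subseteq> {0..<int n}. \<beta> * real n \<le> real (card B) \<longrightarrow>
       (\<exists>x\<in>{1..int X}. \<beta>' * real n \<le> real (card {b\<in>B. b - x \<in> B}))"
    using many_elements_with_common_step[OF Suc.prems] by blast
  obtain X' n0' where IH: "\<And>n B. \<lbrakk>n \<ge> n0'; B \<subseteq> {0..<int n}; \<beta>' * real n \<le> real (card B)\<rbrakk> \<Longrightarrow>
        (\<exists>a xs. length xs = d \<and> set xs \<subseteq> {1..int X'} \<and> cube a xs \<subseteq> B)"
    using Suc.IH[OF \<beta>'] by metis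
  have "\<exists>a xs. length xs = Suc d \<and> set xs \<subseteq> {1..int (max X X')} \<and> cube a xs \<subseteq> B"
    if n: "n \<ge> max n0 n0'" and B: "B \<subseteq> {0..<int n}" "\<beta> * real n \<le> real (card B)" for n B
  proof -
    obtain x where x: "x \<in> {1..int X}" "\<beta>' * real n \<le> real (card {b\<in>B. b - x \<in> B})"
      using step n B by (meson max.boundedE)
    obtain a xs where a: "length xs = d" "set xs \<subseteq> {1..int X'}" "cube a xs \<subseteq> {b\<in>B. b - x \<in> B}"
      using IH[of n "{b\<in>B. b - x \<in> B}"] n B x by auto
    have "cube a (x # xs) \<subseteq> B" using a by auto
    moreover have "set (x # xs) \<subseteq> {1..int (max X X')}" using a(2) x(1) by fastforce
    ultimately show ?thesis using a(1) by (metis length_Cons)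
  qed
  then show ?case by blast
qed

section \<open>Progression-free sets along arithmetic progressions\<close>

definition roth_density :: "real \<Rightarrow> bool" where
  "roth_density \<delta> \<longleftrightarrow>
     (\<exists>n0. \<forall>n\<ge>n0. \<forall>E \<subseteq> {0..<int n}. \<delta> * real n \<le> real (card E) \<longrightarrow> contains_nontrivial_3ap E)"

lemma contains_nontrivial_3ap_affine:
  assumes "contains_nontrivial_3ap {j\<in>J. u + x * j \<in> A}" "x \<noteq> 0"
  shows "contains_nontrivial_3ap A"
proof -
  obtain y r where "r \<noteq> 0" "u + x * y \<in> A" "u + x * (y + r) \<in> A" "u + x * (y + 2 * r) \<in> A"
    using assms(1) unfolding contains_nontrivial_3ap_def by auto
  then show ?thesis
    unfolding contains_nontrivial_3ap_def using assms(2)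
    by (intro exI[of _ "u + x * y"] exI[of _ "x * r"]) (simp add: algebra_simps)
qed

text \<open>
  A progression is an affine copy of an interval, and affine maps preserve three-term progressions.
  The additive constant \<open>L\<close> absorbs the intervals too short for the density \<open>\<gamma>\<close> to force anything.
\<close>

lemma roth_density_progressions:
  assumes "roth_density \<gamma>" "\<gamma> \<ge> 0"
  obtains L :: nat where
    "\<And>A u x n. \<lbrakk>\<not> contains_nontrivial_3ap A; x \<noteq> 0\<rbrakk> \<Longrightarrow>
       real (card (A \<inter> (\<lambda>j. u + x * j) ` {0..<int n})) \<le> \<gamma> * real n + real L"
proof -
  obtain L where L: "\<And>n E. \<lbrakk>n \<ge> L; E \<subseteq> {0..<int n}; \<gamma> * real n \<le> real (card E)\<rbrakk> \<Longrightarrow>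
      contains_nontrivial_3ap E"
    using assms(1) unfolding roth_density_def by blast
  have "real (card (A \<inter> (\<lambda>j. u + x * j) ` {0..<int n})) \<le> \<gamma> * real n + real L"
    if A: "\<not> contains_nontrivial_3ap A" and x: "x \<noteq> 0" for A u x n
  proof -
    define E where "E = {j\<in>{0..<int n}. u + x * j \<in> A}"
    have "A \<inter> (\<lambda>j. u + x * j) ` {0..<int n} = (\<lambda>j. u + x * j) ` E"
      unfolding E_def by auto
    then have card_eq: "card (A \<inter> (\<lambda>j. u + x * j) ` {0..<int n}) = card E"
      using x by (simp add: card_image inj_on_def)
    have sub: "E \<subseteq> {0..<int n}" by (auto simp: E_def)
    have no: "\<not> contains_nontrivial_3ap E"
      using A x contains_nontrivial_3ap_affine unfolding E_def by blast
    show ?thesis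
    proof (cases "n \<ge> L")
      case True
      then have "real (card E) < \<gamma> * real n" using L[OF True sub] no by linarith
      then show ?thesis using card_eq by simp
    next
      case False
      have "card E \<le> card {0..<int n}" using sub by (rule card_mono[rotated]) simp
      then have "real (card E) \<le> real L" using False by simp
      moreover have "0 \<le> \<gamma> * real n" using assms(2) by simp
      ultimately show ?thesis using card_eq by linarith
    qed
  qed
  then show ?thesis using that by blast
qed

text \<open>
  Every finite set \<open>C\<close> is a disjoint union of maximal progressions of difference \<open>x\<close>, one for each
  element \<open>u\<close> with \<open>u - x \<notin> C\<close>. Summing the bound over these runs gives \<open>\<gamma>\<close> per element and \<open>L\<close>
  per run. The induction removes one run at a time.
\<close>

lemma card_Int_le_by_runs:
  fixes C :: "int set"
  assumes "finite C" "x > 0"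
    and bound: "\<And>u n. real (card (A \<inter> (\<lambda>j. u + x * j) ` {0..<int n})) \<le> \<gamma> * real n + L"
  shows "real (card (A \<inter> C)) \<le> \<gamma> * real (card C) + L * real (card {u\<in>C. u - x \<notin> C})"
  using assms(1)
proof (induction "card C" arbitrary: C rule: less_induct)
  case less
  show ?case
  proof (cases "C = {}")
    case False
    \<comment> \<open>The least element of a nonempty set has no predecessor in it, so it starts a run.\<close>
    define u where "u = Min C"
    have u: "u \<in> C" using False less.prems by (simp add: u_def)
    have ux: "u - x \<notin> C"
      using Min_le[OF less.prems, of "u - x"] assms(2) unfolding u_def by linarith
    have "\<exists>n. u + x * int n \<notin> C"
    proof (rule ccontr)
      assume "\<not> ?thesis"
      then have "range (\<lambda>n. u + x * int n) \<subseteq> C" by auto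
      moreover have "inj (\<lambda>n. u + x * int n)" using assms(2) by (auto simp: inj_on_def)
      ultimately show False
        using less.prems finite_subset finite_imageD infinite_UNIV_nat by metis
    qed
    define n where "n = (LEAST n. u + x * int n \<notin> C)"
    have n1: "u + x * int n \<notin> C"
      unfolding n_def using \<open>\<exists>n. u + x * int n \<notin> C\<close> by (rule LeastI_ex)
    have n2: "u + x * int m \<in> C" if "m < n" for m
      using that not_less_Least unfolding n_def by blast
    define P where "P = (\<lambda>j. u + x * j) ` {0..<int n}"
    have PC: "P \<subseteq> C"
    proof
      fix w assume "w \<in> P"
      then obtain j where "j \<in> {0..<int n}" "w = u + x * j" unfolding P_def by blast
      then show "w \<in> C" using n2[of "nat j"] by (simp add: nat_less_iff)
    qed
    have "n > 0" using n1 u by (cases n) auto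
    then have uP: "u \<in> P" unfolding P_def by force
    have card_P: "card P = n"
      unfolding P_def using assms(2) by (simp add: card_image inj_on_def)
    have finP: "finite P" unfolding P_def by simp
    define S where "S = {u\<in>C. u - x \<notin> C}"
    define S' where "S' = {u\<in>C - P. u - x \<notin> C - P}"
    \<comment> \<open>A run that starts after the removal of \<open>P\<close> starts in \<open>C\<close> as well, because \<open>P\<close> was maximal.\<close>
    have "S' \<subseteq> S - {u}"
    proof
      fix w assume w: "w \<in> S'"
      have "w - x \<notin> P"
      proof
        assume "w - x \<in> P"
        then obtain j where "j \<in> {0..<int n}" and wx: "w - x = u + x * j" unfolding P_def by blast
        then have j: "0 \<le> j" "j < int n" by auto
        have weq: "w = u + x * (j + 1)" using wx by (simp add: algebra_simps)
        show False
        proof (cases "j + 1 < int n")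
          case True
          then have "w \<in> P" unfolding P_def weq using j by (intro imageI) auto
          then show False using w unfolding S'_def by simp
        next
          case False
          then have "j + 1 = int n" using j by linarith
          then show False using n1 weq w unfolding S'_def by simp
        qed
      qed
      then show "w \<in> S - {u}" using w uP unfolding S_def S'_def by auto
    qed
    then have "card S' \<le> card (S - {u})"
      using less.prems by (intro card_mono) (auto simp: S_def)
    moreover have "card S > 0" "card (S - {u}) = card S - 1"
      using u ux less.prems by (auto simp: S_def card_gt_0_iff)
    ultimately have card_S: "real (card S') + 1 \<le> real (card S)" by linarith
    have card_CP: "card (C - P) = card C - n" "n \<le> card C"
      using card_Diff_subset[OF finP PC] card_mono[OF less.prems PC] card_P by auto
    have L0: "L \<ge> 0" using bound[of 0 0] by simp
    have IH: "real (card (A \<inter> (C - P))) \<le> \<gamma> * real (card (C - P)) + L * real (card S')"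
      unfolding S'_def using less.prems card_CP \<open>n > 0\<close> by (intro less.hyps) auto
    have "A \<inter> C = (A \<inter> P) \<union> (A \<inter> (C - P))" using PC by auto
    then have "card (A \<inter> C) \<le> card (A \<inter> P) + card (A \<inter> (C - P))"
      by (metis card_Un_le)
    then have "real (card (A \<inter> C)) \<le> real (card (A \<inter> P)) + real (card (A \<inter> (C - P)))"
      by linarith
    also have "\<dots> \<le> (\<gamma> * real n + L) + (\<gamma> * (real (card C) - real n) + L * real (card S'))"
      using bound[of u n] IH card_CP unfolding P_def by (simp add: of_nat_diff)
    also have "\<dots> = \<gamma> * real (card C) + L * (real (card S') + 1)"
      by (simp add: algebra_simps)
    also have "\<dots> \<le> \<gamma> * real (card C) + L * real (card S)"
      using L0 card_S by (intro add_left_mono mult_left_mono) auto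
    finally show ?thesis by (simp add: S_def)
  qed simp
qed

section \<open>Reflecting a cube\<close>

definition reflections :: "int set \<Rightarrow> int set \<Rightarrow> int set" where
  "reflections M Q = (\<lambda>(m, q). 2 * m - q) ` (M \<times> Q)"

lemma reflections_Nil: "reflections M (cube a []) = (\<lambda>m. 2 * m - a) ` M"
  unfolding reflections_def by auto

lemma reflections_Cons:
  "reflections M (cube a (x # xs)) =
     reflections M (cube a xs) \<union> (\<lambda>t. t + x) ` reflections M (cube a xs)"
proof -
  have "reflections M (Q \<union> (\<lambda>q. q - x) ` Q) =
      reflections M Q \<union> (\<lambda>(m, q). 2 * m - (q - x)) ` (M \<times> Q)" for Q
    unfolding reflections_def by auto
  moreover have "(\<lambda>(m, q). 2 * m - (q - x)) ` (M \<times> Q) = (\<lambda>t. t + x) ` reflections M Q" for Q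
    unfolding reflections_def image_image by (rule image_cong) auto
  ultimately show ?thesis by simp
qed

lemma cube_append_subset: "cube a ys \<subseteq> cube a (zs @ ys)"
  by (induction zs) auto

lemma reflections_mono: "Q \<subseteq> Q' \<Longrightarrow> reflections M Q \<subseteq> reflections M Q'"
  unfolding reflections_def by auto

text \<open>
  If \<open>f\<close> grew by more than \<open>s\<close> at every step from \<open>[]\<close> to \<open>xs\<close>, its total growth would be at least
  \<open>s\<close> times the number of steps.
\<close>

lemma exists_slow_growth:
  fixes f :: "'a list \<Rightarrow> real"
  assumes "f xs < f [] + s * real (length xs)"
  obtains zs x ys where "xs = zs @ x # ys" "f (x # ys) \<le> f ys + s"
  using assms
proof (induction xs arbitrary: thesis)
  case (Cons x xs)
  show thesis
  proof (cases "f (x # xs) \<le> f xs + s")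
    case True
    then show thesis using Cons.prems(1)[of "[]"] by simp
  next
    case False
    then have "f xs < f [] + s * real (length xs)"
      using Cons.prems(2) by (simp add: algebra_simps)
    then obtain zs y ys where "xs = zs @ y # ys" "f (y # ys) \<le> f ys + s"
      using Cons.IH by blast
    then show thesis using Cons.prems(1)[of "x # zs"] by simp
  qed
qed simp

text \<open>
  A run of difference \<open>x\<close> in the complement of \<open>T\<close> starts either among the first \<open>x\<close> numbers or at a
  point of \<open>T + x\<close> outside \<open>T\<close>. The growth from \<open>T\<close> to \<open>T \<union> (T + x)\<close>
  bounds the number of starts of the second kind.
\<close>

lemma card_complement_of_slowly_growing:
  fixes T :: "int set"
  assumes T: "T \<subseteq> {0..<int N}" and x: "x > 0"
    and grow: "real (card (T \<union> (\<lambda>t. t + x) ` T)) \<le> real (card T) + s"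
    and bound: "\<And>u n. real (card (A \<inter> (\<lambda>j. u + x * j) ` {0..<int n})) \<le> \<gamma> * real n + L"
    and A: "A \<subseteq> {0..<int N} - T"
  shows "real (card A) \<le> \<gamma> * (real N - real (card T)) + L * (real_of_int x + s)"
proof -
  define C where "C = {0..<int N} - T"
  define D where "D = (\<lambda>t. t + x) ` T - T"
  have finT: "finite T" using T finite_subset by blast
  have "card (T \<union> D) = card T + card D"
    using finT unfolding D_def by (intro card_Un_disjoint) auto
  moreover have "T \<union> D = T \<union> (\<lambda>t. t + x) ` T" unfolding D_def by auto
  ultimately have card_D: "real (card D) \<le> s" using grow by simp
  have "{u\<in>C. u - x \<notin> C} \<subseteq> {0..<x} \<union> D"
  proof
    fix u assume u: "u \<in> {u\<in>C. u - x \<notin> C}"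
    show "u \<in> {0..<x} \<union> D"
    proof (cases "u < x")
      case True
      then show ?thesis using u unfolding C_def by auto
    next
      case False
      then have "u - x \<in> T" "u \<notin> T" using u x unfolding C_def by auto
      then show ?thesis unfolding D_def by (auto intro: image_eqI[of _ _ "u - x"])
    qed
  qed
  then have "card {u\<in>C. u - x \<notin> C} \<le> card ({0..<x} \<union> D)"
    using finT by (intro card_mono) (auto simp: D_def)
  also have "\<dots> \<le> nat x + card D" using card_Un_le[of "{0..<x}" D] by simp
  finally have card_S: "real (card {u\<in>C. u - x \<notin> C}) \<le> real_of_int x + s"
    using card_D x by linarith
  have card_C: "real (card C) = real N - real (card T)"
    unfolding C_def using T finT card_mono[OF _ T] by (simp add: card_Diff_subset of_nat_diff)
  have L0: "L \<ge> 0" using bound[of 0 0] by simp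
  have "A \<inter> C = A" using A unfolding C_def by auto
  then have "real (card A) \<le> \<gamma> * real (card C) + L * real (card {u\<in>C. u - x \<notin> C})"
    using card_Int_le_by_runs[of C x A \<gamma> L] x bound unfolding C_def by simp
  also have "\<dots> \<le> \<gamma> * real (card C) + L * (real_of_int x + s)"
    using card_S L0 by (intro add_left_mono mult_left_mono) auto
  finally show ?thesis using card_C by simp
qed

section \<open>Roth's theorem\<close>

text \<open>
  The self-improvement behind the theorem: a positive threshold density can always be lowered. The
  constants are chosen in the order \<open>L\<close> (from the density \<open>c + \<epsilon>\<close>), the dimension \<open>d\<close> (large
  compared with \<open>L\<close>), the bound \<open>X\<close> on the steps of the cube, and finally \<open>N\<close>. The set of reflections
  has at least about \<open>3 * c * N / 16\<close> elements, so the complement argument saves a multiple of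
  \<open>c\<^sup>2 * N\<close>; taking \<open>\<epsilon> = c\<^sup>2 / 32\<close> keeps the losses below that saving.
\<close>

lemma roth_density_decrease:
  assumes c: "0 < c" "c \<le> 1" and roth: "roth_density (c + c\<^sup>2 / 32)"
  shows "roth_density (c - c\<^sup>2 / 32)"
proof -
  define \<epsilon> where "\<epsilon> = c\<^sup>2 / 32"
  have c2: "0 < c\<^sup>2" "c\<^sup>2 \<le> c" using c by (auto simp: power2_eq_square mult_left_le)
  have \<epsilon>: "0 < \<epsilon>" "\<epsilon> \<le> c / 32" using c2 by (auto simp: \<epsilon>_def)
  obtain L :: nat where L:
    "\<And>A u x n. \<lbrakk>\<not> contains_nontrivial_3ap A; x \<noteq> 0\<rbrakk> \<Longrightarrow>
       real (card (A \<inter> (\<lambda>j. u + x * j) ` {0..<int n})) \<le> (c + \<epsilon>) * real n + real L"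
    using roth_density_progressions[of "c + \<epsilon>"] roth c \<epsilon> unfolding \<epsilon>_def by auto
  obtain d :: nat where d: "32 * real L / c\<^sup>2 < real d"
    using reals_Archimedean2 by blast
  have d0: "d > 0" using d c2 by (cases d) (auto simp: divide_less_0_iff)
  have d_bound: "real L / real d \<le> c\<^sup>2 / 32"
    using d c2 d0 by (simp add: field_simps)
  obtain X n0 where cubes:
    "\<forall>n\<ge>n0. \<forall>B \<subseteq> {0..<int n}. c / 2 * real n \<le> real (card B) \<longrightarrow>
       (\<exists>a xs. length xs = d \<and> set xs \<subseteq> {1..int X} \<and> cube a xs \<subseteq> B)"
    using dense_set_contains_cube[OF half_gt_zero[OF c(1)], of d] by blast
  \<comment> \<open>\<open>K\<close> collects the errors that do not grow with \<open>N\<close>.\<close>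
  define K where "K = real L * real X + real L + 2 * real L * c + 2"
  have K: "real L + 2 \<le> K" "real L * real X + 2 * real L * c + 2 \<le> K"
    using c by (auto simp: K_def)
  obtain n1 :: nat where n1: "64 * K / c\<^sup>2 < real n1"
    using reals_Archimedean2 by blast
  have "contains_nontrivial_3ap A"
    if N: "N \<ge> max n1 (4 * n0 + 4)" and AN: "A \<subseteq> {0..<int N}"
      and card_A: "(c - \<epsilon>) * real N \<le> real (card A)" for N A
  proof (rule ccontr)
    assume no: "\<not> contains_nontrivial_3ap A"
    have N_large: "64 * K < c\<^sup>2 * real N"
    proof -
      have "64 * K / c\<^sup>2 < real N" using n1 N by linarith
      then show ?thesis using c2 by (simp add: field_simps)
    qed
    have cN: "c\<^sup>2 * real N \<le> c * real N" using c2 by (intro mult_right_mono) auto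
    have \<epsilon>N: "\<epsilon> * real N \<le> c * real N / 32"
      using mult_right_mono[OF \<epsilon>(2), of "real N"] by simp
    define k where "k = N div 4"
    have k: "n0 \<le> k" "4 * k \<le> N" "N \<le> 4 * k + 3" using N unfolding k_def by auto
    have finA: "finite A" using AN finite_subset by blast
    have interval: "real (card (A \<inter> {int u..<int v})) \<le> (c + \<epsilon>) * (real v - real u) + real L"
      if "u \<le> v" for u v
    proof -
      have "{int u..<int v} = (\<lambda>j. int u + 1 * j) ` {0..<int (v - u)}"
        using that by (simp add: image_add_atLeastLessThan)
      then show ?thesis using L[OF no, of 1 "int u" "v - u"] that by (simp add: of_nat_diff)
    qed
    define B where "B = A \<inter> {int 0..<int k}"
    define M where "M = A \<inter> {int k..<int (2 * k)}"
    \<comment> \<open>\<open>A\<close> is not much denser than \<open>c\<close> outside a quarter, hence not much sparser on it.\<close>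
    have "A = B \<union> (A \<inter> {int k..<int N})"
      using AN unfolding B_def by auto
    then have "card A \<le> card B + card (A \<inter> {int k..<int N})"
      by (metis card_Un_le)
    then have "real (card A) \<le> real (card B) + real (card (A \<inter> {int k..<int N}))"
      by linarith
    also have "\<dots> \<le> real (card B) + ((c + \<epsilon>) * (real N - real k) + real L)"
      using interval[of k N] k by simp
    finally have "(c - \<epsilon>) * real N \<le> real (card B) + ((c + \<epsilon>) * (real N - real k) + real L)"
      using card_A by linarith
    then have "c * real k + \<epsilon> * real k \<le> real (card B) + 2 * (\<epsilon> * real N) + real L"
      by (simp add: algebra_simps)
    moreover have "c * real N \<le> 4 * (c * real k) + 3 * c"
    proof -
      have "real N \<le> 4 * real k + 3" using k by linarith
      then have "c * real N \<le> c * (4 * real k + 3)" using c by (intro mult_left_mono) auto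
      then show ?thesis by (simp add: algebra_simps)
    qed
    moreover have "0 \<le> \<epsilon> * real k" using \<epsilon> by simp
    ultimately have "c * real k / 2 \<le> real (card B)"
      using \<epsilon>N N_large cN K(1) c by linarith
    then have "c / 2 * real k \<le> real (card B)" by simp
    moreover have "B \<subseteq> {0..<int k}" unfolding B_def by auto
    ultimately obtain a xs where xs: "length xs = d" "set xs \<subseteq> {1..int X}" "cube a xs \<subseteq> B"
      using cubes k(1) by blast
    have "A = B \<union> M \<union> (A \<inter> {int (2 * k)..<int N})"
      using AN k unfolding B_def M_def by auto
    then have "card A \<le> card (B \<union> M) + card (A \<inter> {int (2 * k)..<int N})"
      by (metis card_Un_le)
    then have "real (card A) \<le> real (card B) + real (card M) + real (card (A \<inter> {int (2 * k)..<int N}))"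
      using card_Un_le[of B M] by linarith
    also have "\<dots> \<le> ((c + \<epsilon>) * real k + real L) + real (card M) + ((c + \<epsilon>) * (real N - 2 * real k) + real L)"
      using interval[of "2 * k" N] interval[of 0 k] k unfolding B_def by simp
    finally have "(c - \<epsilon>) * real N \<le> ((c + \<epsilon>) * real k + real L) + real (card M) + ((c + \<epsilon>) * (real N - 2 * real k) + real L)"
      using card_A by linarith
    then have "c * real k + \<epsilon> * real k \<le> real (card M) + 2 * (\<epsilon> * real N) + 2 * real L"
      by (simp add: algebra_simps)
    then have card_M: "c * real N / 4 - c - c * real N / 16 - 2 * real L \<le> real (card M)"
      using \<open>c * real N \<le> 4 * (c * real k) + 3 * c\<close> \<open>0 \<le> \<epsilon> * real k\<close> \<epsilon>N c by linarith
    define T where "T ys = reflections M (cube a ys)" for ys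
    have T_range: "T xs \<subseteq> {0..<int N}"
    proof
      fix t assume "t \<in> T xs"
      then obtain m q where "m \<in> M" "q \<in> cube a xs" "t = 2 * m - q"
        unfolding T_def reflections_def by auto
      then show "t \<in> {0..<int N}" using xs(3) k unfolding B_def M_def by fastforce
    qed
    have T_A: "T xs \<inter> A = {}"
    proof (rule ccontr)
      assume "T xs \<inter> A \<noteq> {}"
      then obtain m q where mq: "m \<in> M" "q \<in> cube a xs" "2 * m - q \<in> A"
        unfolding T_def reflections_def by auto
      have "m \<noteq> q" "m \<in> A" "q \<in> A" using mq xs(3) unfolding B_def M_def by auto
      then have "contains_nontrivial_3ap A"
        unfolding contains_nontrivial_3ap_def using mq(3)
        by (intro exI[of _ q] exI[of _ "m - q"]) (simp add: algebra_simps)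
      then show False using no by simp
    qed
    have card_Nil: "card (T []) = card M"
      unfolding T_def reflections_Nil by (simp add: card_image inj_on_def)
    \<comment> \<open>The \<open>d\<close> steps add fewer than \<open>N\<close> reflections, so one of them adds at most \<open>N / d\<close>.\<close>
    have "card (T xs) \<le> card {0..<int N}" using T_range by (intro card_mono) auto
    then have "real (card (T xs)) \<le> real N" by simp
    moreover have "0 < real (card M)"
      using card_M N_large cN K(1) c by linarith
    ultimately have "real (card (T xs)) < real (card (T [])) + real N / real d * real (length xs)"
      using xs(1) d0 card_Nil by simp
    then obtain zs x ys where split: "xs = zs @ x # ys"
      and grow: "real (card (T (x # ys))) \<le> real (card (T ys)) + real N / real d"
      by (rule exists_slow_growth)
    have x: "x > 0" "x \<le> int X" using xs(2) split by auto
    have "T ys \<subseteq> T xs"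
      unfolding T_def split using cube_append_subset[of a ys "zs @ [x]"]
      by (intro reflections_mono) simp
    then have T_ys: "T ys \<subseteq> {0..<int N}" "A \<subseteq> {0..<int N} - T ys"
      using T_range T_A AN by auto
    have "T [] \<subseteq> T ys"
      unfolding T_def using cube_append_subset[of a "[]" ys]
      by (intro reflections_mono) simp
    then have "card M \<le> card (T ys)"
      using card_Nil card_mono[of "T ys" "T []"] finite_subset[OF T_ys(1)] by simp
    have "real (card A) \<le> (c + \<epsilon>) * (real N - real (card (T ys))) + real L * (real_of_int x + real N / real d)"
    proof (rule card_complement_of_slowly_growing)
      have "T (x # ys) = T ys \<union> (\<lambda>t. t + x) ` T ys"
        unfolding T_def by (rule reflections_Cons)
      then show "real (card (T ys \<union> (\<lambda>t. t + x) ` T ys)) \<le> real (card (T ys)) + real N / real d"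
        using grow by simp
    qed (use T_ys x L[OF no] in auto)
    also have "\<dots> \<le> (c + \<epsilon>) * (real N - real (card M)) + real L * (real X + real N / real d)"
      using x \<open>card M \<le> card (T ys)\<close> c \<epsilon>
      by (intro add_mono mult_left_mono) auto
    also have "real L * (real X + real N / real d) = real L * real X + real L / real d * real N"
      by (simp add: algebra_simps)
    also have "\<dots> \<le> real L * real X + c\<^sup>2 / 32 * real N"
      using d_bound by (intro add_left_mono mult_right_mono) auto
    finally have "(c - \<epsilon>) * real N \<le> (c + \<epsilon>) * (real N - real (card M)) + (real L * real X + c\<^sup>2 / 32 * real N)"
      using card_A by linarith
    moreover have "0 \<le> \<epsilon> * real (card M)" using \<epsilon> by simp
    ultimately have "c * real (card M) \<le> 2 * (\<epsilon> * real N) + real L * real X + c\<^sup>2 / 32 * real N"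
      by (simp add: algebra_simps)
    also have "2 * (\<epsilon> * real N) = c\<^sup>2 * real N / 16" by (simp add: \<epsilon>_def)
    finally have "c * real (card M) \<le> 3 * (c\<^sup>2 * real N) / 32 + real L * real X"
      by (simp add: algebra_simps)
    moreover have "c * (c * real N / 4 - c - c * real N / 16 - 2 * real L) \<le> c * real (card M)"
      using card_M c by (intro mult_left_mono) auto
    moreover have "c * (c * real N / 4 - c - c * real N / 16 - 2 * real L)
        = 3 * (c\<^sup>2 * real N) / 16 - c\<^sup>2 - 2 * real L * c"
      by (simp add: algebra_simps power2_eq_square)
    ultimately show False using N_large K c2 c by linarith
  qed
  then show ?thesis unfolding roth_density_def \<epsilon>_def by blast
qed

text \<open>
  A positive infimum of the forcing densities would contradict the preceding lemma.
\<close>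

theorem roth_theorem:
  assumes "\<delta> > 0"
  shows "roth_density \<delta>"
proof -
  define G where "G = {\<delta>. 0 < \<delta> \<and> roth_density \<delta>}"
  have upward: "roth_density \<gamma>'" if "roth_density \<gamma>" "\<gamma> \<le> \<gamma>'" for \<gamma> \<gamma>'
    using that mult_right_mono[OF that(2)] unfolding roth_density_def
    by (meson of_nat_0_le_iff order_trans)
  have gt1: "roth_density \<gamma>" if "\<gamma> > 1" for \<gamma>
  proof -
    have "\<not> \<gamma> * real n \<le> real (card E)" if "n \<ge> 1" "E \<subseteq> {0..<int n}" for n E
    proof -
      have "card E \<le> card {0..<int n}" using that by (intro card_mono) auto
      moreover have "real n < \<gamma> * real n" using \<open>\<gamma> > 1\<close> that by simp
      ultimately show ?thesis by simp
    qed
    then show ?thesis unfolding roth_density_def by blast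
  qed
  have bdd: "bdd_below G" unfolding G_def by (rule bdd_belowI[of _ 0]) auto
  have ne: "G \<noteq> {}" unfolding G_def using gt1[of 2] by force
  define c where "c = Inf G"
  have "c \<le> 1 + e" if "e > 0" for e :: real
    unfolding c_def using gt1[of "1 + e"] that by (intro cInf_lower bdd) (auto simp: G_def)
  then have c1: "c \<le> 1" by (rule field_le_epsilon)
  have c0: "c \<ge> 0" unfolding c_def using ne by (intro cInf_greatest) (auto simp: G_def)
  have "c = 0"
  proof (rule ccontr)
    assume "c \<noteq> 0"
    then have c: "0 < c" using c0 by simp
    then have "0 < c\<^sup>2 / 32" "c\<^sup>2 \<le> c" using c1 by (auto simp: power2_eq_square mult_left_le)
    then have "Inf G < c + c\<^sup>2 / 32" unfolding c_def by simp
    then obtain \<gamma> where "\<gamma> \<in> G" "\<gamma> < c + c\<^sup>2 / 32"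
      using cInf_lessD[OF ne] by blast
    then have "roth_density (c + c\<^sup>2 / 32)" using upward unfolding G_def by force
    then have "roth_density (c - c\<^sup>2 / 32)" using roth_density_decrease c c1 by blast
    then have "c - c\<^sup>2 / 32 \<in> G" using \<open>c\<^sup>2 \<le> c\<close> c unfolding G_def by simp
    then have "c \<le> c - c\<^sup>2 / 32" unfolding c_def using bdd by (intro cInf_lower) auto
    then show False using \<open>0 < c\<^sup>2 / 32\<close> by simp
  qed
  then have "Inf G < \<delta>" using assms unfolding c_def by simp
  then obtain \<gamma> where "\<gamma> \<in> G" "\<gamma> < \<delta>"
    using cInf_lessD[OF ne] by blast
  then show ?thesis using upward unfolding G_def by force
qed

section \<open>Fourier norms and progressions\<close>

theorem theorem1p3:
  "\<exists>M :: real \<Rightarrow> real \<Rightarrow> ennreal.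
     (\<forall>\<delta>>0. antimono_on {2..3} (M \<delta>) \<and> M \<delta> 3 = ennreal (root 3 2 * \<delta>) \<and> M \<delta> 2 = \<infinity>) \<and>
     (\<forall>q\<in>{2..3}. \<forall>\<delta>>0. \<forall>\<^sub>F N :: nat in sequentially.
        \<forall>E \<subseteq> {0..<int N}.
          real (card E) / real N \<ge> \<delta> \<longrightarrow>
          ennreal (fourier_lq_norm N q E) < M \<delta> q \<longrightarrow>
          contains_nontrivial_3ap E)"
proof -
  define M :: "real \<Rightarrow> real \<Rightarrow> ennreal"
    where "M \<delta> q = (if q = 2 then \<infinity> else ennreal (root 3 2 * \<delta>))" for \<delta> q
  have "antimono_on {2..3} (M \<delta>)" for \<delta>
    by (rule monotone_onI) (auto simp: M_def)
  moreover have "\<forall>\<^sub>F N :: nat in sequentially. \<forall>E \<subseteq> {0..<int N}.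
      real (card E) / real N \<ge> \<delta> \<longrightarrow> contains_nontrivial_3ap E" if pos: "\<delta> > 0" for \<delta>
  proof -
    obtain n0 where n0: "\<And>n E. \<lbrakk>n \<ge> n0; E \<subseteq> {0..<int n}; \<delta> * real n \<le> real (card E)\<rbrakk> \<Longrightarrow>
        contains_nontrivial_3ap E"
      using roth_theorem[OF pos] unfolding roth_density_def by blast
    show ?thesis
      using eventually_ge_at_top[of "max n0 1"]
      by eventually_elim (auto intro!: n0 simp: field_simps)
  qed
  then have "\<forall>\<^sub>F N :: nat in sequentially. \<forall>E \<subseteq> {0..<int N}.
      real (card E) / real N \<ge> \<delta> \<longrightarrow> ennreal (fourier_lq_norm N q E) < M \<delta> q \<longrightarrow>
      contains_nontrivial_3ap E" if "\<delta> > 0" for \<delta> q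
    by (rule eventually_mono[OF _ ]) (use that in auto)
  ultimately show ?thesis
    by (intro exI[of _ M]) (auto simp: M_def)
qed

end
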